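(* Consider the RLC circuit $-L\dot I=\Gamma V+RI-Bu_s$, $C\dot V=\Gamma^\top I-GV$ and its extended dynamics (obtained by adjoining the time-differentiated equations $-L\ddot I=\Gamma\dot V+R\dot I-B\upsilon_s$, $C\ddot V=\Gamma^\top\dot I-G\dot V$ and $\dot u_s=\upsilon_s$), with extended state $(I,V,\dot I,\dot V,u_s)$ and input $\upsilon_s\in\mathbb{R}^m$. Assume: $L,C$ constant symmetric positive definite; $R,G$ symmetric positive semi-definite; $I,V$ (and $\dot I,\dot V$) are measured; and there exist a constant $V^\star\in\mathbb{R}^\rho_+$, a constant $\bar u_s\in\mathbb{R}^m$ and $\bar I\in\mathbb{R}^\sigma$ with $0=\Gamma V^\star+R\bar I-B\bar u_s$, $0=\Gamma^\top\bar I-GV^\star$. Apply the control $$\upsilon_s=\mu_s-k_iB^\top(I-\bar I)-k_dy_s,\qquad y_s=B^\top\dot I,$$ with scalars $k_d>0$, $k_i>0$ and new input $\mu_s\in\mathbb{R}^m$. Then: (a) the closed-loop system defines a passive map $\mu_s\mapsto y_s$; (b) if $\mu_s=0$ and either (i) $R>0$ and $G>0$, or (ii) $G>0$ and $\Gamma^\top$ has full column rank, then the solution of the closed-loop system asymptotically converges to the set $$\{(I,V,\dot I,\dot V,u_s):\ \dot V=0,\ \dot I=0,\ \dot u_s=0,\ B^\top(I-\bar I)=0\}.$$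
   Context: $I\in\mathbb{R}^\sigma$, $V\in\mathbb{R}^\rho$, $u_s\in\mathbb{R}^m$; $\Gamma\in\mathbb{R}^{\sigma\times\rho}$; $B\in\mathbb{R}^{\sigma\times m}$ has full column rank. A map $\mu\mapsto y$ is passive if there is a storage function $S\ge0$ of the (closed-loop) state with $\dot S\le\mu^\top y$ along trajectories. $R>0$ means symmetric positive definite. *)

theory Defs
  imports "HOL-Analysis.Analysis"
begin

text \<open>Index types: 's (sigma branches, currents I), 'r (rho nodes, voltages V), 'm (m sources).
  A matrix M :: real^'c^'r has rows indexed by 'r and columns indexed by 'c.\<close>

definition sym_pd :: "real^'n^'n \<Rightarrow> bool" where
  "sym_pd M \<longleftrightarrow> transpose M = M \<and> (\<forall>x. x \<noteq> 0 \<longrightarrow> x \<bullet> (M *v x) > 0)"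

definition sym_psd :: "real^'n^'n \<Rightarrow> bool" where
  "sym_psd M \<longleftrightarrow> transpose M = M \<and> (\<forall>x. x \<bullet> (M *v x) \<ge> 0)"

definition full_col_rank :: "real^'c^'r \<Rightarrow> bool" where
  "full_col_rank M \<longleftrightarrow> rank M = CARD('c)"

text \<open>Control law: upsilon_s = mu_s - k_i B^T (I - Ibar) - k_d y_s, with y_s = B^T Idot.\<close>
definition ctrl ::
  "real^'m^'s \<Rightarrow> real \<Rightarrow> real \<Rightarrow> real^'s \<Rightarrow> real^'m \<Rightarrow> real^'s \<Rightarrow> real^'s \<Rightarrow> real^'m" where
  "ctrl B ki kd Ibar mu I Ip = mu - ki *\<^sub>R (transpose B *v (I - Ibar)) - kd *\<^sub>R (transpose B *v Ip)"

definition out_y :: "real^'m^'s \<Rightarrow> real^'s \<Rightarrow> real^'m" where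
  "out_y B Ip = transpose B *v Ip"

text \<open>A solution on [0,\<infinity>) of the closed-loop extended dynamics with extended state
  (I, V, Idot, Vdot, u_s) and new input mu:
   d/dt I = Idot, d/dt V = Vdot,
   -L d/dt Idot = Gamma Vdot + R Idot - B upsilon_s,
    C d/dt Vdot = Gamma^T Idot - G Vdot,
   d/dt u_s = upsilon_s, with upsilon_s given by the control law.\<close>
definition cl_traj ::
  "real^'s^'s \<Rightarrow> real^'r^'r \<Rightarrow> real^'s^'s \<Rightarrow> real^'r^'r \<Rightarrow> real^'r^'s \<Rightarrow> real^'m^'s
   \<Rightarrow> real \<Rightarrow> real \<Rightarrow> real^'s \<Rightarrow> (real \<Rightarrow> real^'m)
   \<Rightarrow> (real \<Rightarrow> real^'s) \<Rightarrow> (real \<Rightarrow> real^'r) \<Rightarrow> (real \<Rightarrow> real^'s) \<Rightarrow> (real \<Rightarrow> real^'r)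
   \<Rightarrow> (real \<Rightarrow> real^'m) \<Rightarrow> bool" where
  "cl_traj L C R G \<Gamma> B ki kd Ibar mu I V Ip Vp u \<longleftrightarrow>
     (\<forall>t\<ge>0.
        (I has_vector_derivative Ip t) (at t within {0..}) \<and>
        (V has_vector_derivative Vp t) (at t within {0..}) \<and>
        (\<exists>Ipp. (Ip has_vector_derivative Ipp) (at t within {0..}) \<and>
               - (L *v Ipp) = \<Gamma> *v Vp t + R *v Ip t - B *v ctrl B ki kd Ibar (mu t) (I t) (Ip t)) \<and>
        (\<exists>Vpp. (Vp has_vector_derivative Vpp) (at t within {0..}) \<and>
               C *v Vpp = transpose \<Gamma> *v Ip t - G *v Vp t) \<and>
        (u has_vector_derivative ctrl B ki kd Ibar (mu t) (I t) (Ip t)) (at t within {0..}))"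

text \<open>Target set {(I,V,Idot,Vdot,u_s). Vdot = 0, Idot = 0, d/dt u_s = 0, B^T(I - Ibar) = 0},
  where (with mu_s = 0) d/dt u_s is the closed-loop value of upsilon_s.\<close>
definition target_set ::
  "real^'m^'s \<Rightarrow> real \<Rightarrow> real \<Rightarrow> real^'s
   \<Rightarrow> ((real^'s) \<times> (real^'r) \<times> (real^'s) \<times> (real^'r) \<times> (real^'m)) set" where
  "target_set B ki kd Ibar =
     {(I, V, Ip, Vp, u). Vp = 0 \<and> Ip = 0 \<and> ctrl B ki kd Ibar 0 I Ip = 0 \<and>
                         transpose B *v (I - Ibar) = 0}"

end

theory Submission
  imports Defs
begin

text \<open>
  Write \<open>a = I'\<close>, \<open>v = V'\<close> and \<open>z = B\<^sup>T (I - Ibar)\<close>. Along the closed loop \<open>(a, v, z)\<close>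
  solves the autonomous linear system \<open>L a' = B (\<mu> - k\<^sub>i z - k\<^sub>d B\<^sup>T a) - \<Gamma> v - R a\<close>,
  \<open>C v' = \<Gamma>\<^sup>T a - G v\<close>, \<open>z' = B\<^sup>T a\<close>.

  (a) The energy \<open>S = (a\<^sup>T L a + v\<^sup>T C v + k\<^sub>i |z|\<^sup>2) / 2\<close> satisfies
  \<open>S' = \<mu>\<^sup>T y - a\<^sup>T R a - v\<^sup>T G v - k\<^sub>d |y|\<^sup>2 \<le> \<mu>\<^sup>T y\<close> with \<open>y = B\<^sup>T a\<close>.

  (b) For \<open>\<mu> = 0\<close> the dissipation of \<open>S\<close> does not control \<open>z\<close>. Adding the cross terms
  \<open>e\<^sub>2 (L a)\<^sup>T B z - e\<^sub>1 (C v)\<^sup>T \<Gamma>\<^sup>T a\<close> with suitably small \<open>e\<^sub>1, e\<^sub>2 > 0\<close> yields a function \<open>W\<close>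
  comparable to \<open>|(a, v, z)|\<^sup>2\<close> with \<open>W' \<le> -\<delta> |(a, v, z)|\<^sup>2\<close>: the first cross term contributes
  \<open>-k\<^sub>i |B z|\<^sup>2\<close>, the second \<open>-|\<Gamma>\<^sup>T a|\<^sup>2\<close>, which damps the currents when \<open>R\<close> alone does not.
  So \<open>(a, v, z)\<close> decays exponentially, and its norm bounds the distance to the target set.
\<close>

section \<open>Matrix estimates\<close>

lemma inner_matrix_vector_transpose:
  "(x::real^'n) \<bullet> (M *v y) = (transpose M *v x) \<bullet> (y::real^'m)"
  by (metis dot_lmul_matrix transpose_transpose vector_transpose_matrix)

lemma inner_le_mult_bound:
  assumes "norm x \<le> \<alpha>" "norm y \<le> \<beta>"
  shows "\<bar>x \<bullet> y\<bar> \<le> \<alpha> * \<beta>"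
proof -
  have "norm x * norm y \<le> \<alpha> * \<beta>"
    by (rule mult_mono[OF assms order_trans[OF norm_ge_zero assms(1)] norm_ge_zero])
  then show ?thesis
    using Cauchy_Schwarz_ineq2[of x y] by linarith
qed

lemma matrix_vector_mult_minus_right: "(A::real^'n^'m) *v (- x) = - (A *v x)"
  using matrix_vector_mult_diff_distrib[of A 0 x] by simp

lemma matrix_vector_mult_norm_le_onorm:
  "norm ((M::real^'n^'m) *v x) \<le> onorm ((*v) M) * norm x"
  by (rule onorm[OF matrix_vector_mul_bounded_linear])

lemma matrix_vector_mult_norm_le:
  "onorm ((*v) M) \<le> K \<Longrightarrow> norm ((M::real^'n^'m) *v x) \<le> K * norm x"
  by (rule order_trans[OF matrix_vector_mult_norm_le_onorm mult_right_mono]) simp_all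

lemma matrix_vector_mult_injective_norm_ge:
  assumes "inj ((*v) (M::real^'n^'m))"
  shows "\<exists>c>0. \<forall>x. c * norm x \<le> norm (M *v x)"
  using injective_imp_isometric[of UNIV "(*v) M"] assms
  by (metis closed_UNIV subspace_UNIV matrix_vector_mul_bounded_linear injD
      matrix_vector_mult_0_right UNIV_I)

lemma full_col_rank_norm_ge:
  assumes "full_col_rank M"
  shows "\<exists>c>0. \<forall>x. c * norm x \<le> norm (M *v x)"
  using assms matrix_vector_mult_injective_norm_ge
  by (simp add: full_col_rank_def full_rank_injective)

lemma full_col_rank_transpose_right_inverse:
  assumes "full_col_rank (M::real^'c^'r)"
  obtains P :: "real^'c^'r" where "\<And>w. transpose M *v (P *v w) = w"
proof -
  have "rank (transpose M) = CARD('c)"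
    using assms by (simp add: full_col_rank_def rank_transpose)
  then have "surj ((*v) (transpose M))"
    by (rule full_rank_surjective[THEN iffD1])
  then obtain P :: "real^'c^'r" where "transpose M ** P = mat 1"
    using matrix_right_invertible_surjective[of "transpose M"] by auto
  then show thesis
    using that[of P] by (simp add: matrix_vector_mul_assoc)
qed

lemma quadratic_form_coercive:
  assumes "\<forall>x. x \<noteq> 0 \<longrightarrow> (x::real^'n) \<bullet> (M *v x) > 0"
  shows "\<exists>c>0. \<forall>x. c * (norm x)\<^sup>2 \<le> x \<bullet> (M *v x)"
proof -
  have "continuous_on (sphere (0::real^'n) 1) (\<lambda>x. x \<bullet> (M *v x))"
    by (intro continuous_intros)
  moreover have "sphere (0::real^'n) 1 \<noteq> {}"
    by simp
  ultimately obtain y where y: "y \<in> sphere 0 1"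
    and y_min: "\<forall>x\<in>sphere 0 1. y \<bullet> (M *v y) \<le> x \<bullet> (M *v x)"
    using continuous_attains_inf[OF compact_sphere] by blast
  have "y \<bullet> (M *v y) * (norm x)\<^sup>2 \<le> x \<bullet> (M *v x)" for x
  proof (cases "x = 0")
    case False
    have "x /\<^sub>R norm x \<in> sphere 0 1"
      using False by simp
    then have "y \<bullet> (M *v y) \<le> (x /\<^sub>R norm x) \<bullet> (M *v (x /\<^sub>R norm x))"
      using y_min by blast
    also have "\<dots> = (x \<bullet> (M *v x)) / (norm x)\<^sup>2"
      using False by (simp add: matrix_vector_mult_scaleR power2_eq_square field_simps)
    finally show ?thesis
      using False by (simp add: field_simps)
  qed simp
  moreover have "y \<bullet> (M *v y) > 0"
  proof -
    have "y \<noteq> 0"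
      using y by auto
    then show ?thesis
      using assms by blast
  qed
  ultimately show ?thesis by blast
qed

lemma sym_pd_coercive:
  "sym_pd M \<Longrightarrow> \<exists>c>0. \<forall>x. c * (norm x)\<^sup>2 \<le> x \<bullet> (M *v x)"
  unfolding sym_pd_def by (blast intro: quadratic_form_coercive)

lemma coercive_norm_le:
  assumes "c * (norm x)\<^sup>2 \<le> x \<bullet> (M *v x)" "0 < c"
  shows "c * norm x \<le> norm (M *v x)"
proof (cases "x = 0")
  case False
  have "c * (norm x)\<^sup>2 \<le> norm x * norm (M *v x)"
    using assms(1) Cauchy_Schwarz_ineq2[of x "M *v x", THEN abs_le_D1] by (rule order_trans)
  then have "norm x * (c * norm x) \<le> norm x * norm (M *v x)"
    by (simp add: power2_eq_square algebra_simps)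
  then show ?thesis
    using False by simp
qed simp

lemma power2_norm_triple:
  "(norm (a, v, z))\<^sup>2 = (norm a)\<^sup>2 + (norm v)\<^sup>2 + (norm z)\<^sup>2"
  by (simp add: norm_Pair)

lemma norm_diff4_le: "norm (- p - q - r - s) \<le> norm p + norm q + norm r + norm s"
proof -
  have "norm (- p - q - r - s) \<le> norm (- p - q - r) + norm s"
    by (rule norm_triangle_ineq4)
  moreover have "norm (- p - q - r) \<le> norm (- p - q) + norm r"
    by (rule norm_triangle_ineq4)
  moreover have "norm (- p - q) \<le> norm p + norm q"
    using norm_triangle_ineq4[of "- p" q] by simp
  ultimately show ?thesis
    by linarith
qed

section \<open>Derivatives of quadratic expressions\<close>

lemma has_vector_derivative_matrix_vector_mult:
  "(g has_vector_derivative g') F \<Longrightarrow>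
    ((\<lambda>t. (M::real^'n^'m) *v g t) has_vector_derivative M *v g') F"
  by (rule bounded_linear.has_vector_derivative[OF matrix_vector_mul_bounded_linear])

lemma has_real_derivative_inner:
  assumes "(f has_vector_derivative f') (at x within s)" "(g has_vector_derivative g') (at x within s)"
  shows "((\<lambda>t. f t \<bullet> g t) has_real_derivative f' \<bullet> g x + f x \<bullet> g') (at x within s)"
  using bounded_bilinear.has_vector_derivative[OF bounded_bilinear_inner assms]
  by (simp add: has_real_derivative_iff_has_vector_derivative add.commute)

lemma quadratic_form_has_derivative:
  fixes M :: "real^'n^'n"
  assumes "transpose M = M" "(x has_vector_derivative x') (at t within T)"
  shows "((\<lambda>\<tau>. x \<tau> \<bullet> (M *v x \<tau>)) has_real_derivative 2 * (x t \<bullet> (M *v x'))) (at t within T)"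
proof -
  have "x' \<bullet> (M *v x t) = (transpose M *v x') \<bullet> x t"
    by (rule inner_matrix_vector_transpose)
  also have "\<dots> = x t \<bullet> (M *v x')"
    unfolding assms(1) by (rule inner_commute)
  finally have "x' \<bullet> (M *v x t) = x t \<bullet> (M *v x')" .
  with has_real_derivative_inner[OF assms(2) has_vector_derivative_matrix_vector_mult[OF assms(2), of M]]
  show ?thesis
    by (simp only: mult_2)
qed

section \<open>Quadratic Lyapunov functions\<close>

lemma young_product:
  fixes c u w \<eta> :: real
  assumes "0 < \<eta>"
  shows "c * u * w \<le> c\<^sup>2 / \<eta> * u\<^sup>2 + \<eta> / 4 * w\<^sup>2"
proof -
  have "0 \<le> (c * u - \<eta> / 2 * w)\<^sup>2" by simp
  then have "\<eta> * (c * u * w) \<le> \<eta> * (c\<^sup>2 / \<eta> * u\<^sup>2 + \<eta> / 4 * w\<^sup>2)"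
    using assms by (simp add: power2_eq_square algebra_simps)
  then show ?thesis
    using assms by simp
qed

lemma sum3_mult_le:
  fixes p q s c P Q S :: real
  assumes "0 \<le> P" "0 \<le> Q" "0 \<le> S" "p \<le> c" "q \<le> c" "s \<le> c"
  shows "p * P + q * Q + s * S \<le> c * (P + Q + S)"
  unfolding distrib_left using assms by (intro add_mono mult_right_mono) auto

lemma strict_lyapunov_gains:
  fixes \<rho> \<theta> g k c d l :: real
  assumes "0 \<le> \<rho>" "0 \<le> \<theta>" "0 < \<rho> + \<theta>" "0 < g" "0 < k" "0 \<le> c" "0 \<le> d" "0 < l"
  shows "\<exists>e1 e2 \<delta>. 0 < e1 \<and> 0 < e2 \<and> 0 < \<delta> \<and>
    (\<forall>X Y Z. - \<rho> * X\<^sup>2 - g * Y\<^sup>2 + e2 * (c * (X\<^sup>2 + X * Z + Y * Z) - k * Z\<^sup>2)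
              + e1 * (c * (X * Y + Y\<^sup>2 + Y * Z) - \<theta> * X\<^sup>2) \<le> - \<delta> * (X\<^sup>2 + Y\<^sup>2 + Z\<^sup>2)) \<and>
    (\<forall>X Y Z. d * (e2 * X * Z + e1 * X * Y) \<le> l * (X\<^sup>2 + Y\<^sup>2 + Z\<^sup>2))"
proof -
  (* The ratio \<kappa> = e2 / e1 is fixed first, so that the X-terms of the e2-bracket are absorbed by
     the damping e1 p X^2; then e1 = \<epsilon> is taken small for the Y-terms and for the coupling size. *)
  define p where "p = \<rho> + \<theta>"
  define Q where "Q = c + c\<^sup>2 / k + 1"
  define \<kappa> where "\<kappa> = p / (4 * Q)"
  define M where "M = \<kappa> * c\<^sup>2 / k + c + c\<^sup>2 / p + c\<^sup>2 / (\<kappa> * k)"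
  define \<epsilon> where "\<epsilon> = min 1 (min (g / (2 * M + 1)) (l / (d * (1 + \<kappa>) + 1)))"
  define \<delta> where "\<delta> = min (\<epsilon> * p / 2) (min (g / 2) (\<epsilon> * \<kappa> * k / 4))"
  have p: "0 < p"
    using assms by (simp add: p_def)
  have Q: "0 < Q"
    using assms by (simp add: Q_def add_nonneg_pos)
  have \<kappa>: "0 < \<kappa>" "\<kappa> * (c + c\<^sup>2 / k) \<le> p / 4"
  proof -
    show "0 < \<kappa>"
      using p Q by (simp add: \<kappa>_def)
    have "\<kappa> * (c + c\<^sup>2 / k) \<le> \<kappa> * Q"
      using \<open>0 < \<kappa>\<close> by (simp add: Q_def)
    also have "\<dots> = p / 4"
      using Q by (simp add: \<kappa>_def)
    finally show "\<kappa> * (c + c\<^sup>2 / k) \<le> p / 4" .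
  qed
  have M: "0 \<le> M"
    using assms p \<kappa> by (simp add: M_def)
  have d\<kappa>: "0 < d * (1 + \<kappa>) + 1"
    using assms \<kappa> by (intro add_nonneg_pos mult_nonneg_nonneg) auto
  have \<epsilon>: "0 < \<epsilon>" "\<epsilon> \<le> 1" "\<epsilon> * M \<le> g / 2" "d * \<epsilon> * (1 + \<kappa>) \<le> l"
  proof -
    show "0 < \<epsilon>" "\<epsilon> \<le> 1"
      using assms M d\<kappa> by (simp_all add: \<epsilon>_def)
    have "\<epsilon> * (2 * M + 1) \<le> g"
      using M by (simp add: \<epsilon>_def pos_le_divide_eq[symmetric])
    then show "\<epsilon> * M \<le> g / 2"
      using \<open>0 < \<epsilon>\<close> by (simp add: algebra_simps)
    have "\<epsilon> * (d * (1 + \<kappa>) + 1) \<le> l"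
      using d\<kappa> by (simp add: \<epsilon>_def pos_le_divide_eq[symmetric])
    then show "d * \<epsilon> * (1 + \<kappa>) \<le> l"
      using \<open>0 < \<epsilon>\<close> by (simp add: algebra_simps)
  qed
  have \<delta>: "0 < \<delta>" "\<delta> \<le> \<epsilon> * p / 2" "\<delta> \<le> g / 2" "\<delta> \<le> \<epsilon> * \<kappa> * k / 4"
    using \<epsilon> \<kappa> p assms by (simp_all add: \<delta>_def)
  have rate: "- \<rho> * X\<^sup>2 - g * Y\<^sup>2 + \<epsilon> * \<kappa> * (c * (X\<^sup>2 + X * Z + Y * Z) - k * Z\<^sup>2)
      + \<epsilon> * (c * (X * Y + Y\<^sup>2 + Y * Z) - \<theta> * X\<^sup>2) \<le> - \<delta> * (X\<^sup>2 + Y\<^sup>2 + Z\<^sup>2)" for X Y Z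
  proof -
    have XZ: "c * X * Z \<le> c\<^sup>2 / k * X\<^sup>2 + k / 4 * Z\<^sup>2"
      using young_product assms by blast
    have YZ: "c * Y * Z \<le> c\<^sup>2 / k * Y\<^sup>2 + k / 4 * Z\<^sup>2"
      using young_product assms by blast
    have YZ': "c * Y * Z \<le> c\<^sup>2 / (\<kappa> * k) * Y\<^sup>2 + \<kappa> * k / 4 * Z\<^sup>2"
      using young_product \<kappa> assms by simp
    have XY: "c * X * Y \<le> c\<^sup>2 / p * Y\<^sup>2 + p / 4 * X\<^sup>2"
      using young_product[OF p, of c Y X] by (simp add: mult.commute mult.left_commute)
    have \<epsilon>\<kappa>: "0 \<le> \<epsilon> * \<kappa>"
      using \<epsilon> \<kappa> by simp
    have \<rho>: "\<epsilon> * \<rho> * X\<^sup>2 \<le> \<rho> * X\<^sup>2"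
      using \<epsilon> assms by (intro mult_right_mono) (simp_all add: mult_left_le_one_le)
    show ?thesis
      using mult_left_mono[OF XZ \<epsilon>\<kappa>] mult_left_mono[OF YZ \<epsilon>\<kappa>]
        mult_left_mono[OF YZ', of \<epsilon>] mult_left_mono[OF XY, of \<epsilon>] \<rho>
        mult_left_mono[OF \<kappa>(2), of "\<epsilon> * X\<^sup>2"] mult_left_mono[OF \<epsilon>(3), of "Y\<^sup>2"]
        mult_right_mono[OF \<delta>(2), of "X\<^sup>2"] mult_right_mono[OF \<delta>(3), of "Y\<^sup>2"]
        mult_right_mono[OF \<delta>(4), of "Z\<^sup>2"] \<epsilon>
      by (simp add: p_def M_def algebra_simps add_divide_distrib)
  qed
  have coupling: "d * (\<epsilon> * \<kappa> * X * Z + \<epsilon> * X * Y) \<le> l * (X\<^sup>2 + Y\<^sup>2 + Z\<^sup>2)" for X Y Z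
  proof -
    have XZ: "X * Z \<le> X\<^sup>2 + Y\<^sup>2 + Z\<^sup>2" and XY: "X * Y \<le> X\<^sup>2 + Y\<^sup>2 + Z\<^sup>2"
      using sum_squares_bound[of X Z] sum_squares_bound[of X Y]
        zero_le_power2[of X] zero_le_power2[of Y] zero_le_power2[of Z] by linarith+
    have "d * (\<epsilon> * \<kappa> * X * Z + \<epsilon> * X * Y) = d * \<epsilon> * \<kappa> * (X * Z) + d * \<epsilon> * (X * Y)"
      by (simp add: algebra_simps)
    also have "\<dots> \<le> d * \<epsilon> * \<kappa> * (X\<^sup>2 + Y\<^sup>2 + Z\<^sup>2) + d * \<epsilon> * (X\<^sup>2 + Y\<^sup>2 + Z\<^sup>2)"
      using XZ XY assms \<epsilon> \<kappa> by (intro add_mono mult_left_mono) auto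
    also have "\<dots> = d * \<epsilon> * (1 + \<kappa>) * (X\<^sup>2 + Y\<^sup>2 + Z\<^sup>2)"
      by (simp add: algebra_simps)
    also have "\<dots> \<le> l * (X\<^sup>2 + Y\<^sup>2 + Z\<^sup>2)"
      using \<epsilon>(4) by (intro mult_right_mono) auto
    finally show ?thesis .
  qed
  show ?thesis
    using rate coupling \<epsilon> \<kappa> \<delta> by (intro exI[of _ \<epsilon>] exI[of _ "\<epsilon> * \<kappa>"] exI[of _ \<delta>]) (simp add: mult.assoc)
qed

lemma quadratic_lyapunov_tendsto_zero:
  fixes x :: "real \<Rightarrow> 'a::real_normed_vector" and W :: "real \<Rightarrow> real"
  assumes "0 < m" "0 < M" "0 < \<delta>"
    and lower: "\<And>t. 0 \<le> t \<Longrightarrow> m * (norm (x t))\<^sup>2 \<le> W t"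
    and upper: "\<And>t. 0 \<le> t \<Longrightarrow> W t \<le> M * (norm (x t))\<^sup>2"
    and rate: "\<And>t. 0 \<le> t \<Longrightarrow>
      \<exists>D. (W has_real_derivative D) (at t within {0..}) \<and> D \<le> - \<delta> * (norm (x t))\<^sup>2"
  shows "(x \<longlongrightarrow> 0) at_top"
proof -
  define \<eta> where "\<eta> = \<delta> / M"
  have \<eta>: "0 < \<eta>"
    using assms by (simp add: \<eta>_def)
  define \<psi> where "\<psi> t = exp (\<eta> * t) * W t" for t
  have \<psi>_rate: "\<exists>D. (\<psi> has_real_derivative D) (at t within {0..}) \<and> D \<le> 0" if t: "0 \<le> t" for t
  proof -
    obtain D where D: "(W has_real_derivative D) (at t within {0..})" "D \<le> - \<delta> * (norm (x t))\<^sup>2"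
      using rate[OF t] by blast
    have \<psi>_deriv: "(\<psi> has_real_derivative exp (\<eta> * t) * (D + \<eta> * W t)) (at t within {0..})"
      unfolding \<psi>_def by (auto intro!: derivative_eq_intros D simp: algebra_simps)
    have "\<eta> * W t \<le> \<delta> * (norm (x t))\<^sup>2"
      using mult_left_mono[OF upper[OF t], of \<eta>] \<eta> assms by (simp add: \<eta>_def)
    then have "exp (\<eta> * t) * (D + \<eta> * W t) \<le> 0"
      using D(2) by (intro mult_nonneg_nonpos) auto
    with \<psi>_deriv show ?thesis
      by blast
  qed
  have \<psi>_decreasing: "\<psi> t \<le> \<psi> 0" if "0 \<le> t" for t
  proof (rule DERIV_nonpos_imp_decreasing_open[OF that])
    fix s :: real
    assume "0 < s" "s < t"
    then have "at s within {0..} = at s"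
      by (intro at_within_interior) simp
    then show "\<exists>D. (\<psi> has_real_derivative D) (at s) \<and> D \<le> 0"
      using \<psi>_rate[of s] \<open>0 < s\<close> by auto
  next
    show "continuous_on {0..t} \<psi>"
      unfolding continuous_on_eq_continuous_within
    proof
      fix s
      assume "s \<in> {0..t}"
      then obtain D where "(\<psi> has_real_derivative D) (at s within {0..})"
        using \<psi>_rate[of s] by auto
      then show "continuous (at s within {0..t}) \<psi>"
        by (rule continuous_within_subset[OF DERIV_continuous]) auto
    qed
  qed
  have norm_bound: "norm (x t) \<le> sqrt (W 0 / m * exp (- \<eta> * t))" if "0 \<le> t" for t
  proof -
    have "W t * exp (\<eta> * t) \<le> W 0"
      using \<psi>_decreasing[OF that] by (simp add: \<psi>_def mult.commute)
    then have "W t \<le> W 0 * exp (- \<eta> * t)"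
      by (simp add: exp_minus field_simps)
    then have "m * (norm (x t))\<^sup>2 \<le> W 0 * exp (- \<eta> * t)"
      using lower[OF that] by linarith
    then have "(norm (x t))\<^sup>2 \<le> W 0 / m * exp (- \<eta> * t)"
      using assms by (simp add: field_simps)
    from real_sqrt_le_mono[OF this] show ?thesis
      by simp
  qed
  have "((\<lambda>t. exp (- \<eta> * t)) \<longlongrightarrow> 0) at_top"
    using filterlim_compose[OF exp_at_bot filterlim_tendsto_neg_mult_at_bot[OF tendsto_const _ filterlim_ident],
        of "- \<eta>"] \<eta>
    by simp
  then have "((\<lambda>t. W 0 / m * exp (- \<eta> * t)) \<longlongrightarrow> 0) at_top"
    by (rule tendsto_mult_right_zero)
  from tendsto_real_sqrt[OF this]
  have bound_tendsto: "((\<lambda>t. sqrt (W 0 / m * exp (- \<eta> * t))) \<longlongrightarrow> 0) at_top"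
    by simp
  have "\<forall>\<^sub>F t in at_top. norm (x t) \<le> sqrt (W 0 / m * exp (- \<eta> * t))"
    using eventually_ge_at_top[of 0] by eventually_elim (rule norm_bound)
  then show ?thesis
    using bound_tendsto by (rule Lim_null_comparison)
qed

section \<open>The closed loop\<close>

lemma infdist_target_set_le:
  fixes B :: "real^'m^'s"
  assumes "full_col_rank B"
  obtains K where "\<And>I (V :: real^'r) Ip Vp u. infdist (I, V, Ip, Vp, u) (target_set B ki kd Ibar)
    \<le> K * norm (Ip, Vp, transpose B *v (I - Ibar))"
proof -
  obtain P where P: "\<And>w. transpose B *v (P *v w) = w"
    using full_col_rank_transpose_right_inverse[OF assms] by blast
  show thesis
  proof (rule that)
    fix I Ip :: "real^'s" and V Vp :: "real^'r" and u :: "real^'m"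
    define z where "z = transpose B *v (I - Ibar)"
    have "transpose B *v (I - P *v z - Ibar) = 0"
      using P[of z] by (simp add: z_def matrix_vector_mult_diff_distrib)
    then have "(I - P *v z, V, 0, 0, u) \<in> target_set B ki kd Ibar"
      by (simp add: target_set_def ctrl_def)
    then have "infdist (I, V, Ip, Vp, u) (target_set B ki kd Ibar)
        \<le> dist (I, V, Ip, Vp, u) (I - P *v z, V, 0, 0, u)"
      by (rule infdist_le)
    also have "\<dots> = norm (P *v z, 0::real^'r, Ip, Vp, 0::real^'m)"
      by (simp add: dist_norm)
    also have "\<dots> \<le> norm (P *v z) + norm Ip + norm Vp"
    proof -
      have "norm (P *v z, 0::real^'r, Ip, Vp, 0::real^'m) \<le> norm (P *v z) + norm (Ip, Vp, 0::real^'m)"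
        using norm_Pair_le[of "P *v z" "(0::real^'r, Ip, Vp, 0::real^'m)"] by simp
      moreover have "norm (Ip, Vp, 0::real^'m) \<le> norm Ip + norm Vp"
        using norm_Pair_le[of Ip "(Vp, 0::real^'m)"] by simp
      ultimately show ?thesis
        by linarith
    qed
    also have "\<dots> \<le> (onorm ((*v) P) + 2) * norm (Ip, Vp, z)"
    proof -
      have "norm Ip \<le> norm (Ip, Vp, z)" "norm Vp \<le> norm (Ip, Vp, z)" "norm z \<le> norm (Ip, Vp, z)"
        by (rule norm_fst_le order_trans[OF norm_fst_le norm_snd_le] order_trans[OF norm_snd_le norm_snd_le])+
      moreover have "onorm ((*v) P) * norm z \<le> onorm ((*v) P) * norm (Ip, Vp, z)"
        using \<open>norm z \<le> norm (Ip, Vp, z)\<close> by (intro mult_left_mono onorm_pos_le) auto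
      ultimately show ?thesis
        using matrix_vector_mult_norm_le_onorm[of P z] unfolding distrib_right by linarith
    qed
    finally show "infdist (I, V, Ip, Vp, u) (target_set B ki kd Ibar)
        \<le> (onorm ((*v) P) + 2) * norm (Ip, Vp, transpose B *v (I - Ibar))"
      by (simp add: z_def)
  qed
qed

locale rlc_closed_loop =
  fixes L R :: "real^'s^'s" and C G :: "real^'r^'r" and \<Gamma> :: "real^'r^'s"
    and B :: "real^'m^'s" and ki kd :: real
  assumes L: "sym_pd L" and C: "sym_pd C" and R: "sym_psd R" and G: "sym_psd G"
    and ki: "0 < ki" and kd: "0 < kd"
begin

(* a, v, z stand for I', V', B^T (I - Ibar) and a', v' for I'', V''. *)
definition error_dynamics ::
  "real^'m \<Rightarrow> real^'s \<Rightarrow> real^'r \<Rightarrow> real^'m \<Rightarrow> real^'s \<Rightarrow> real^'r \<Rightarrow> bool" where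
  "error_dynamics \<mu> a v z a' v' \<longleftrightarrow>
     L *v a' = B *v (\<mu> - ki *\<^sub>R z - kd *\<^sub>R (transpose B *v a)) - \<Gamma> *v v - R *v a \<and>
     C *v v' = transpose \<Gamma> *v a - G *v v"

definition energy :: "real^'s \<Rightarrow> real^'r \<Rightarrow> real^'m \<Rightarrow> real" where
  "energy a v z = (a \<bullet> (L *v a) + v \<bullet> (C *v v) + ki * (z \<bullet> z)) / 2"

definition energy_rate ::
  "real^'s \<Rightarrow> real^'r \<Rightarrow> real^'m \<Rightarrow> real^'s \<Rightarrow> real^'r \<Rightarrow> real^'m \<Rightarrow> real" where
  "energy_rate a v z a' v' z' = a \<bullet> (L *v a') + v \<bullet> (C *v v') + ki * (z \<bullet> z')"

definition coupling :: "real \<Rightarrow> real \<Rightarrow> real^'s \<Rightarrow> real^'r \<Rightarrow> real^'m \<Rightarrow> real" where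
  "coupling e1 e2 a v z = e2 * ((L *v a) \<bullet> (B *v z)) - e1 * ((C *v v) \<bullet> (transpose \<Gamma> *v a))"

definition coupling_rate :: "real \<Rightarrow> real \<Rightarrow>
    real^'s \<Rightarrow> real^'r \<Rightarrow> real^'m \<Rightarrow> real^'s \<Rightarrow> real^'r \<Rightarrow> real^'m \<Rightarrow> real" where
  "coupling_rate e1 e2 a v z a' v' z' =
     e2 * ((L *v a') \<bullet> (B *v z) + (L *v a) \<bullet> (B *v z'))
     - e1 * ((C *v v') \<bullet> (transpose \<Gamma> *v a) + (C *v v) \<bullet> (transpose \<Gamma> *v a'))"

definition matrix_bound :: real where
  "matrix_bound = onorm ((*v) L) + onorm ((*v) R) + onorm ((*v) C) + onorm ((*v) G)
     + onorm ((*v) \<Gamma>) + onorm ((*v) (transpose \<Gamma>)) + onorm ((*v) B) + onorm ((*v) (transpose B))"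

lemma matrix_bound_nonneg: "0 \<le> matrix_bound"
  unfolding matrix_bound_def by (intro add_nonneg_nonneg onorm_pos_le matrix_vector_mul_bounded_linear)

lemma norm_le_matrix_bound:
  "norm (L *v a) \<le> matrix_bound * norm a" "norm (R *v a) \<le> matrix_bound * norm a"
  "norm (C *v v) \<le> matrix_bound * norm v" "norm (G *v v) \<le> matrix_bound * norm v"
  "norm (\<Gamma> *v v) \<le> matrix_bound * norm v" "norm (transpose \<Gamma> *v a) \<le> matrix_bound * norm a"
  "norm (B *v z) \<le> matrix_bound * norm z" "norm (transpose B *v a) \<le> matrix_bound * norm a"
  using onorm_pos_le[OF matrix_vector_mul_bounded_linear, of L]
    onorm_pos_le[OF matrix_vector_mul_bounded_linear, of R]
    onorm_pos_le[OF matrix_vector_mul_bounded_linear, of C]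
    onorm_pos_le[OF matrix_vector_mul_bounded_linear, of G]
    onorm_pos_le[OF matrix_vector_mul_bounded_linear, of \<Gamma>]
    onorm_pos_le[OF matrix_vector_mul_bounded_linear, of "transpose \<Gamma>"]
    onorm_pos_le[OF matrix_vector_mul_bounded_linear, of B]
    onorm_pos_le[OF matrix_vector_mul_bounded_linear, of "transpose B"]
  by (intro matrix_vector_mult_norm_le; simp add: matrix_bound_def)+

lemma norm_B_transpose_B_le: "norm (B *v (transpose B *v a)) \<le> matrix_bound * (matrix_bound * norm a)"
  using norm_le_matrix_bound(7)[of "transpose B *v a"]
    mult_left_mono[OF norm_le_matrix_bound(8)[of a] matrix_bound_nonneg]
  by simp

lemma error_dynamics_zero_input:
  "error_dynamics 0 a v z a' v' \<Longrightarrow>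
    L *v a' = - (ki *\<^sub>R (B *v z)) - kd *\<^sub>R (B *v (transpose B *v a)) - \<Gamma> *v v - R *v a"
  by (simp add: error_dynamics_def matrix_vector_mult_diff_distrib matrix_vector_mult_scaleR
      matrix_vector_mult_minus_right)

lemma energy_has_derivative:
  assumes "(a has_vector_derivative a') (at t within T)" "(v has_vector_derivative v') (at t within T)"
    "(z has_vector_derivative z') (at t within T)"
  shows "((\<lambda>\<tau>. energy (a \<tau>) (v \<tau>) (z \<tau>)) has_real_derivative energy_rate (a t) (v t) (z t) a' v' z')
    (at t within T)"
proof -
  have "transpose L = L" "transpose C = C"
    using L C by (simp_all add: sym_pd_def)
  then have "((\<lambda>\<tau>. energy (a \<tau>) (v \<tau>) (z \<tau>)) has_real_derivative
      (2 * (a t \<bullet> (L *v a')) + 2 * (v t \<bullet> (C *v v')) + ki * (z' \<bullet> z t + z t \<bullet> z')) / 2) (at t within T)"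
    unfolding energy_def
    by (intro DERIV_cdivide DERIV_add DERIV_cmult quadratic_form_has_derivative
        has_real_derivative_inner assms)
  then show ?thesis
    by (rule DERIV_cong) (simp add: energy_rate_def inner_commute)
qed

lemma coupling_has_derivative:
  assumes "(a has_vector_derivative a') (at t within T)" "(v has_vector_derivative v') (at t within T)"
    "(z has_vector_derivative z') (at t within T)"
  shows "((\<lambda>\<tau>. coupling e1 e2 (a \<tau>) (v \<tau>) (z \<tau>)) has_real_derivative
    coupling_rate e1 e2 (a t) (v t) (z t) a' v' z') (at t within T)"
  unfolding coupling_def coupling_rate_def
  by (intro DERIV_diff DERIV_cmult has_real_derivative_inner has_vector_derivative_matrix_vector_mult assms)

lemma energy_rate_eq:
  assumes "error_dynamics \<mu> a v z a' v'"
  shows "energy_rate a v z a' v' (transpose B *v a)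
    = \<mu> \<bullet> (transpose B *v a) - a \<bullet> (R *v a) - v \<bullet> (G *v v) - kd * (norm (transpose B *v a))\<^sup>2"
proof -
  have "a \<bullet> (L *v a') = (transpose B *v a) \<bullet> (\<mu> - ki *\<^sub>R z - kd *\<^sub>R (transpose B *v a))
      - (transpose \<Gamma> *v a) \<bullet> v - a \<bullet> (R *v a)"
    using assms by (simp add: error_dynamics_def inner_diff_right inner_matrix_vector_transpose[of a B]
        inner_matrix_vector_transpose[of a \<Gamma>])
  moreover have "v \<bullet> (C *v v') = (transpose \<Gamma> *v a) \<bullet> v - v \<bullet> (G *v v)"
    using assms by (simp add: error_dynamics_def inner_diff_right inner_commute)
  ultimately show ?thesis
    by (simp add: energy_rate_def inner_diff_right inner_commute power2_norm_eq_inner algebra_simps)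
qed

lemma energy_rate_le_dissipation:
  assumes "error_dynamics \<mu> a v z a' v'"
  shows "energy_rate a v z a' v' (transpose B *v a) \<le> \<mu> \<bullet> (transpose B *v a) - a \<bullet> (R *v a) - v \<bullet> (G *v v)"
proof -
  have "0 \<le> kd * (norm (transpose B *v a))\<^sup>2"
    using kd by simp
  then show ?thesis
    using energy_rate_eq[OF assms] by linarith
qed

lemma energy_norm_bounds:
  obtains l M where "0 < l" "0 < M" "\<And>a v z. l * (norm (a, v, z))\<^sup>2 \<le> energy a v z"
    "\<And>a v z. energy a v z \<le> M * (norm (a, v, z))\<^sup>2"
proof -
  obtain lL where lL: "0 < lL" "\<And>a. lL * (norm a)\<^sup>2 \<le> a \<bullet> (L *v a)"
    using sym_pd_coercive[OF L] by blast
  obtain lC where lC: "0 < lC" "\<And>v. lC * (norm v)\<^sup>2 \<le> v \<bullet> (C *v v)"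
    using sym_pd_coercive[OF C] by blast
  define l where "l = min lL (min lC ki) / 2"
  define M where "M = (matrix_bound + ki) / 2"
  show thesis
  proof (rule that)
    show "0 < l" "0 < M"
      using lL lC ki matrix_bound_nonneg by (simp_all add: l_def M_def)
  next
    fix a :: "real^'s" and v :: "real^'r" and z :: "real^'m"
    have "2 * l * (norm a)\<^sup>2 \<le> lL * (norm a)\<^sup>2" "2 * l * (norm v)\<^sup>2 \<le> lC * (norm v)\<^sup>2"
      "2 * l * (norm z)\<^sup>2 \<le> ki * (norm z)\<^sup>2"
      by (intro mult_right_mono; simp add: l_def)+
    then show "l * (norm (a, v, z))\<^sup>2 \<le> energy a v z"
      using lL(2)[of a] lC(2)[of v]
      by (simp add: energy_def power2_norm_triple power2_norm_eq_inner algebra_simps)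
  next
    fix a :: "real^'s" and v :: "real^'r" and z :: "real^'m"
    have "\<bar>a \<bullet> (L *v a)\<bar> \<le> norm a * (matrix_bound * norm a)"
      "\<bar>v \<bullet> (C *v v)\<bar> \<le> norm v * (matrix_bound * norm v)"
      using norm_le_matrix_bound by (intro inner_le_mult_bound; simp)+
    then have "a \<bullet> (L *v a) \<le> matrix_bound * (norm a)\<^sup>2" "v \<bullet> (C *v v) \<le> matrix_bound * (norm v)\<^sup>2"
      by (simp_all add: power2_eq_square algebra_simps abs_le_iff)
    moreover have "z \<bullet> z = (norm z)\<^sup>2"
      by (simp add: power2_norm_eq_inner)
    moreover have "0 \<le> ki * (norm a)\<^sup>2" "0 \<le> ki * (norm v)\<^sup>2" "0 \<le> matrix_bound * (norm z)\<^sup>2"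
      using ki matrix_bound_nonneg by simp_all
    ultimately show "energy a v z \<le> M * (norm (a, v, z))\<^sup>2"
      unfolding energy_def M_def power2_norm_triple by (simp add: algebra_simps add_divide_distrib)
  qed
qed

lemma cl_traj_error_dynamics:
  assumes "cl_traj L C R G \<Gamma> B ki kd Ibar mu I V Ip Vp u" "0 \<le> t"
  obtains Ipp Vpp where "(Ip has_vector_derivative Ipp) (at t within {0..})"
    "(Vp has_vector_derivative Vpp) (at t within {0..})"
    "((\<lambda>\<tau>. transpose B *v (I \<tau> - Ibar)) has_vector_derivative transpose B *v Ip t) (at t within {0..})"
    "error_dynamics (mu t) (Ip t) (Vp t) (transpose B *v (I t - Ibar)) Ipp Vpp"
proof -
  obtain Ipp Vpp where I: "(I has_vector_derivative Ip t) (at t within {0..})"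
    and Ipp: "(Ip has_vector_derivative Ipp) (at t within {0..})"
      "- (L *v Ipp) = \<Gamma> *v Vp t + R *v Ip t - B *v ctrl B ki kd Ibar (mu t) (I t) (Ip t)"
    and Vpp: "(Vp has_vector_derivative Vpp) (at t within {0..})"
      "C *v Vpp = transpose \<Gamma> *v Ip t - G *v Vp t"
    using assms unfolding cl_traj_def by blast
  have "((\<lambda>\<tau>. transpose B *v (I \<tau> - Ibar)) has_vector_derivative transpose B *v Ip t) (at t within {0..})"
    by (intro has_vector_derivative_matrix_vector_mult) (simp add: has_vector_derivative_diff_const I)
  moreover have "error_dynamics (mu t) (Ip t) (Vp t) (transpose B *v (I t - Ibar)) Ipp Vpp"
    using arg_cong[OF Ipp(2), of uminus] Vpp(2) by (simp add: error_dynamics_def ctrl_def algebra_simps)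
  ultimately show thesis
    using Ipp(1) Vpp(1) that by blast
qed

lemma closed_loop_passive:
  "\<exists>S :: real^'s \<Rightarrow> real^'r \<Rightarrow> real^'s \<Rightarrow> real^'r \<Rightarrow> real^'m \<Rightarrow> real.
     (\<forall>I V Ip Vp u. S I V Ip Vp u \<ge> 0) \<and>
     (\<forall>mu I V Ip Vp u t. cl_traj L C R G \<Gamma> B ki kd Ibar mu I V Ip Vp u \<and> t \<ge> 0 \<longrightarrow>
        (\<exists>D. ((\<lambda>\<tau>. S (I \<tau>) (V \<tau>) (Ip \<tau>) (Vp \<tau>) (u \<tau>)) has_real_derivative D) (at t within {0..}) \<and>
             D \<le> mu t \<bullet> out_y B (Ip t)))"
proof -
  define S :: "real^'s \<Rightarrow> real^'r \<Rightarrow> real^'s \<Rightarrow> real^'r \<Rightarrow> real^'m \<Rightarrow> real"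
    where "S I V Ip Vp u = energy Ip Vp (transpose B *v (I - Ibar))" for I V Ip Vp u
  obtain l where l: "0 < l" "\<And>a v z. l * (norm (a, v, z))\<^sup>2 \<le> energy a v z"
    by (rule energy_norm_bounds) (rule that)
  have "S I V Ip Vp u \<ge> 0" for I V Ip Vp u
  proof -
    have "0 \<le> l * (norm (Ip, Vp, transpose B *v (I - Ibar)))\<^sup>2"
      using l(1) by simp
    then show ?thesis
      using l(2) unfolding S_def by (rule order_trans)
  qed
  moreover have "\<exists>D. ((\<lambda>\<tau>. S (I \<tau>) (V \<tau>) (Ip \<tau>) (Vp \<tau>) (u \<tau>)) has_real_derivative D) (at t within {0..}) \<and>
      D \<le> mu t \<bullet> out_y B (Ip t)"
    if traj: "cl_traj L C R G \<Gamma> B ki kd Ibar mu I V Ip Vp u" and t: "0 \<le> t" for mu I V Ip Vp u t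
  proof -
    obtain Ipp Vpp where Ipp: "(Ip has_vector_derivative Ipp) (at t within {0..})"
      and Vpp: "(Vp has_vector_derivative Vpp) (at t within {0..})"
      and z: "((\<lambda>\<tau>. transpose B *v (I \<tau> - Ibar)) has_vector_derivative transpose B *v Ip t) (at t within {0..})"
      and ed: "error_dynamics (mu t) (Ip t) (Vp t) (transpose B *v (I t - Ibar)) Ipp Vpp"
      by (rule cl_traj_error_dynamics[OF traj t]) (rule that)
    have "0 \<le> Ip t \<bullet> (R *v Ip t)" "0 \<le> Vp t \<bullet> (G *v Vp t)"
      using R G by (simp_all add: sym_psd_def)
    then have "energy_rate (Ip t) (Vp t) (transpose B *v (I t - Ibar)) Ipp Vpp (transpose B *v Ip t)
        \<le> mu t \<bullet> out_y B (Ip t)"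
      using energy_rate_le_dissipation[OF ed] unfolding out_y_def by linarith
    with energy_has_derivative[OF Ipp Vpp z] show ?thesis
      unfolding S_def by blast
  qed
  ultimately show ?thesis
    by blast
qed

(* Under (i) R damps the currents directly; under (ii) they are damped only through their
   coupling \<Gamma>^T to the voltages, which the cross term -(C v)^T \<Gamma>^T a exposes. *)
lemma current_damping:
  assumes "sym_pd R \<or> full_col_rank (transpose \<Gamma>)"
  obtains \<rho> \<theta> where "0 \<le> \<rho>" "0 \<le> \<theta>" "0 < \<rho> + \<theta>"
    "\<And>a. \<rho> * (norm a)\<^sup>2 \<le> a \<bullet> (R *v a)" "\<And>a. \<theta> * (norm a)\<^sup>2 \<le> (norm (transpose \<Gamma> *v a))\<^sup>2"
  using assms
proof
  assume "sym_pd R"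
  then obtain \<rho> where "0 < \<rho>" "\<And>a. \<rho> * (norm a)\<^sup>2 \<le> a \<bullet> (R *v a)"
    using sym_pd_coercive by blast
  then show thesis
    using that[of \<rho> 0] by simp
next
  assume "full_col_rank (transpose \<Gamma>)"
  then obtain c where c: "0 < c" "\<And>a. c * norm a \<le> norm (transpose \<Gamma> *v a)"
    using full_col_rank_norm_ge by blast
  have "c\<^sup>2 * (norm a)\<^sup>2 \<le> (norm (transpose \<Gamma> *v a))\<^sup>2" for a
    using power_mono[OF c(2)[of a], of 2] c(1) by (simp add: power_mult_distrib)
  moreover have "0 * (norm a)\<^sup>2 \<le> a \<bullet> (R *v a)" for a
    using R by (simp add: sym_psd_def)
  ultimately show thesis
    using that[of 0 "c\<^sup>2"] c(1) by simp
qed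

lemma coupling_bound:
  assumes "0 \<le> e1" "0 \<le> e2"
  shows "\<bar>coupling e1 e2 a v z\<bar> \<le> matrix_bound\<^sup>2 * (e2 * norm a * norm z + e1 * norm a * norm v)"
proof -
  have "\<bar>(L *v a) \<bullet> (B *v z)\<bar> \<le> matrix_bound * norm a * (matrix_bound * norm z)"
    "\<bar>(C *v v) \<bullet> (transpose \<Gamma> *v a)\<bar> \<le> matrix_bound * norm v * (matrix_bound * norm a)"
    using norm_le_matrix_bound by (intro inner_le_mult_bound; simp)+
  then have "e2 * \<bar>(L *v a) \<bullet> (B *v z)\<bar> \<le> e2 * (matrix_bound * norm a * (matrix_bound * norm z))"
    "e1 * \<bar>(C *v v) \<bullet> (transpose \<Gamma> *v a)\<bar> \<le> e1 * (matrix_bound * norm v * (matrix_bound * norm a))"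
    using assms by (simp_all add: mult_left_mono)
  moreover have "\<bar>coupling e1 e2 a v z\<bar>
      \<le> \<bar>e2 * ((L *v a) \<bullet> (B *v z))\<bar> + \<bar>e1 * ((C *v v) \<bullet> (transpose \<Gamma> *v a))\<bar>"
    unfolding coupling_def by (rule abs_triangle_ineq4)
  moreover have "\<bar>e2 * ((L *v a) \<bullet> (B *v z))\<bar> + \<bar>e1 * ((C *v v) \<bullet> (transpose \<Gamma> *v a))\<bar>
      = e2 * \<bar>(L *v a) \<bullet> (B *v z)\<bar> + e1 * \<bar>(C *v v) \<bullet> (transpose \<Gamma> *v a)\<bar>"
    using assms by (simp only: abs_mult abs_of_nonneg)
  moreover have "e2 * (matrix_bound * norm a * (matrix_bound * norm z))
      + e1 * (matrix_bound * norm v * (matrix_bound * norm a))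
      = matrix_bound\<^sup>2 * (e2 * norm a * norm z + e1 * norm a * norm v)"
    by (simp add: power2_eq_square algebra_simps)
  ultimately show ?thesis
    by linarith
qed

lemma current_coupling_rate_bound:
  assumes "full_col_rank B"
  obtains c k where "0 \<le> c" "0 < k"
    "\<And>a v z a' v'. error_dynamics 0 a v z a' v' \<Longrightarrow>
      (L *v a') \<bullet> (B *v z) + (L *v a) \<bullet> (B *v (transpose B *v a))
      \<le> c * ((norm a)\<^sup>2 + norm a * norm z + norm v * norm z) - k * (norm z)\<^sup>2"
proof -
  obtain b where b: "0 < b" "\<And>z. b * norm z \<le> norm (B *v z)"
    using full_col_rank_norm_ge[OF assms] by blast
  define K where "K = matrix_bound"
  have K: "0 \<le> K"
    using matrix_bound_nonneg by (simp add: K_def)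
  have KK: "0 \<le> K * K" "0 \<le> K * K * K" "0 \<le> kd * K * K * K"
    using K kd by (simp_all add: mult_nonneg_nonneg)
  show thesis
  proof (rule that)
    show "0 \<le> K * K + K * K * K + kd * K * K * K" and "0 < ki * b\<^sup>2"
      using KK ki b by simp_all
  next
    fix a :: "real^'s" and v :: "real^'r" and z :: "real^'m" and a' v'
    assume "error_dynamics 0 a v z a' v'"
    then have "(L *v a') \<bullet> (B *v z) = - (ki * (norm (B *v z))\<^sup>2)
        - kd * ((B *v (transpose B *v a)) \<bullet> (B *v z)) - (\<Gamma> *v v) \<bullet> (B *v z) - (R *v a) \<bullet> (B *v z)"
      by (simp add: error_dynamics_zero_input inner_diff_left power2_norm_eq_inner)
    moreover have "ki * b\<^sup>2 * (norm z)\<^sup>2 \<le> ki * (norm (B *v z))\<^sup>2"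
      using power_mono[OF b(2)[of z], of 2] b(1) ki by (simp add: power_mult_distrib)
    moreover have BBt_B: "\<bar>(B *v (transpose B *v a)) \<bullet> (B *v z)\<bar> \<le> K * (K * norm a) * (K * norm z)"
      and \<Gamma>_B: "\<bar>(\<Gamma> *v v) \<bullet> (B *v z)\<bar> \<le> K * norm v * (K * norm z)"
      and R_B: "\<bar>(R *v a) \<bullet> (B *v z)\<bar> \<le> K * norm a * (K * norm z)"
      and L_BBt: "\<bar>(L *v a) \<bullet> (B *v (transpose B *v a))\<bar> \<le> K * norm a * (K * (K * norm a))"
      using norm_B_transpose_B_le norm_le_matrix_bound by (intro inner_le_mult_bound; simp add: K_def)+
    moreover have "- (kd * ((B *v (transpose B *v a)) \<bullet> (B *v z))) \<le> kd * K * K * K * (norm a * norm z)"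
      using mult_left_mono[OF BBt_B[THEN abs_le_D2], of kd] kd by (simp add: algebra_simps)
    moreover have "- ((\<Gamma> *v v) \<bullet> (B *v z)) \<le> K * K * (norm v * norm z)"
      using \<Gamma>_B[THEN abs_le_D2] by (simp add: algebra_simps)
    moreover have "- ((R *v a) \<bullet> (B *v z)) \<le> K * K * (norm a * norm z)"
      using R_B[THEN abs_le_D2] by (simp add: algebra_simps)
    moreover have "(L *v a) \<bullet> (B *v (transpose B *v a)) \<le> K * K * K * (norm a)\<^sup>2"
      using L_BBt[THEN abs_le_D1] by (simp add: power2_eq_square algebra_simps)
    moreover have "K * K * K * (norm a)\<^sup>2 + (K * K + kd * K * K * K) * (norm a * norm z)
        + K * K * (norm v * norm z)
        \<le> (K * K + K * K * K + kd * K * K * K) * ((norm a)\<^sup>2 + norm a * norm z + norm v * norm z)"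
      by (intro sum3_mult_le) (use KK in auto)
    moreover have "(K * K + kd * K * K * K) * (norm a * norm z)
        = K * K * (norm a * norm z) + kd * K * K * K * (norm a * norm z)"
      by (simp add: distrib_right)
    ultimately show "(L *v a') \<bullet> (B *v z) + (L *v a) \<bullet> (B *v (transpose B *v a))
        \<le> (K * K + K * K * K + kd * K * K * K) * ((norm a)\<^sup>2 + norm a * norm z + norm v * norm z)
          - ki * b\<^sup>2 * (norm z)\<^sup>2"
      by linarith
  qed
qed

lemma current_rate_norm_le:
  obtains q where "0 \<le> q"
    "\<And>a v z a' v'. error_dynamics 0 a v z a' v' \<Longrightarrow>
      norm a' \<le> q * (ki * norm z + kd * matrix_bound * norm a + norm v + norm a)"
proof -
  obtain lL where lL: "0 < lL" "\<And>a. lL * (norm a)\<^sup>2 \<le> a \<bullet> (L *v a)"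
    using sym_pd_coercive[OF L] by blast
  show thesis
  proof (rule that)
    show "0 \<le> matrix_bound / lL"
      using matrix_bound_nonneg lL(1) by simp
  next
    fix a :: "real^'s" and v :: "real^'r" and z :: "real^'m" and a' v'
    assume ed: "error_dynamics 0 a v z a' v'"
    have "lL * norm a' \<le> norm (L *v a')"
      by (rule coercive_norm_le[OF lL(2) lL(1)])
    also have "\<dots> \<le> norm (ki *\<^sub>R (B *v z)) + norm (kd *\<^sub>R (B *v (transpose B *v a)))
        + norm (\<Gamma> *v v) + norm (R *v a)"
      unfolding error_dynamics_zero_input[OF ed] by (rule norm_diff4_le)
    also have "\<dots> \<le> ki * (matrix_bound * norm z) + kd * (matrix_bound * (matrix_bound * norm a))
        + matrix_bound * norm v + matrix_bound * norm a"
      using norm_le_matrix_bound norm_B_transpose_B_le ki kd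
      by (intro add_mono) (simp_all add: mult_left_mono)
    also have "\<dots> = matrix_bound * (ki * norm z + kd * matrix_bound * norm a + norm v + norm a)"
      by (simp add: algebra_simps)
    finally show "norm a' \<le> matrix_bound / lL * (ki * norm z + kd * matrix_bound * norm a + norm v + norm a)"
      using lL(1) by (simp add: field_simps)
  qed
qed

lemma voltage_coupling_rate_bound:
  obtains c where "0 \<le> c"
    "\<And>a v z a' v'. error_dynamics 0 a v z a' v' \<Longrightarrow>
      - ((C *v v') \<bullet> (transpose \<Gamma> *v a) + (C *v v) \<bullet> (transpose \<Gamma> *v a'))
      \<le> c * (norm a * norm v + (norm v)\<^sup>2 + norm v * norm z) - (norm (transpose \<Gamma> *v a))\<^sup>2"
proof -
  obtain q where q: "0 \<le> q"
    "\<And>a v z a' v'. error_dynamics 0 a v z a' v' \<Longrightarrow>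
      norm a' \<le> q * (ki * norm z + kd * matrix_bound * norm a + norm v + norm a)"
    by (rule current_rate_norm_le) (rule that)
  define K where "K = matrix_bound"
  define r where "r = K * K * q"
  have K: "0 \<le> K"
    using matrix_bound_nonneg by (simp add: K_def)
  have rK: "0 \<le> r * ki" "0 \<le> K * K + r * (kd * K + ki)" "0 \<le> K * K + r * (1 + kd * K)"
    using K q(1) kd ki by (simp_all add: r_def mult_nonneg_nonneg add_nonneg_nonneg)
  show thesis
  proof (rule that)
    show "0 \<le> K * K + r * (1 + kd * K + ki)"
      using rK(1,3) by (simp add: algebra_simps)
  next
    fix a :: "real^'s" and v :: "real^'r" and z :: "real^'m" and a' v'
    assume ed: "error_dynamics 0 a v z a' v'"
    have "K * norm v * (K * norm a')
        \<le> K * norm v * (K * (q * (ki * norm z + kd * K * norm a + norm v + norm a)))"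
      using q(2)[OF ed] K by (intro mult_left_mono) (auto simp: K_def)
    also have "\<dots> = r * ki * (norm v * norm z) + r * (kd * K + 1) * (norm a * norm v) + r * (norm v)\<^sup>2"
      by (simp add: r_def power2_eq_square algebra_simps)
    finally have "K * norm v * (K * norm a')
        \<le> r * ki * (norm v * norm z) + r * (kd * K + 1) * (norm a * norm v) + r * (norm v)\<^sup>2" .
    moreover have "\<bar>(C *v v) \<bullet> (transpose \<Gamma> *v a')\<bar> \<le> K * norm v * (K * norm a')"
      using norm_le_matrix_bound by (intro inner_le_mult_bound; simp add: K_def)
    moreover have "\<bar>(G *v v) \<bullet> (transpose \<Gamma> *v a)\<bar> \<le> K * K * (norm a * norm v)"
      using inner_le_mult_bound[OF norm_le_matrix_bound(4) norm_le_matrix_bound(6), of v a]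
      by (simp add: K_def algebra_simps)
    moreover have "(C *v v') \<bullet> (transpose \<Gamma> *v a)
        = (norm (transpose \<Gamma> *v a))\<^sup>2 - (G *v v) \<bullet> (transpose \<Gamma> *v a)"
      using ed by (simp add: error_dynamics_def inner_diff_left power2_norm_eq_inner)
    moreover have "(K * K + r * (kd * K + 1)) * (norm a * norm v) + r * (norm v)\<^sup>2
        + r * ki * (norm v * norm z)
        \<le> (K * K + r * (1 + kd * K + ki)) * (norm a * norm v + (norm v)\<^sup>2 + norm v * norm z)"
      by (intro sum3_mult_le) (use rK in \<open>simp_all add: algebra_simps\<close>)
    moreover have "(K * K + r * (kd * K + 1)) * (norm a * norm v)
        = K * K * (norm a * norm v) + r * (kd * K + 1) * (norm a * norm v)"
      by (simp add: distrib_right)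
    ultimately show "- ((C *v v') \<bullet> (transpose \<Gamma> *v a) + (C *v v) \<bullet> (transpose \<Gamma> *v a'))
        \<le> (K * K + r * (1 + kd * K + ki)) * (norm a * norm v + (norm v)\<^sup>2 + norm v * norm z)
          - (norm (transpose \<Gamma> *v a))\<^sup>2"
      by (simp only: abs_le_iff) linarith
  qed
qed

lemma lyapunov_rate_estimate:
  assumes "full_col_rank B" "(sym_pd R \<and> sym_pd G) \<or> (sym_pd G \<and> full_col_rank (transpose \<Gamma>))"
  obtains \<rho> \<theta> g k c where "0 \<le> \<rho>" "0 \<le> \<theta>" "0 < \<rho> + \<theta>" "0 < g" "0 < k" "0 \<le> c"
    "\<And>e1 e2 a v z a' v'. 0 \<le> e1 \<Longrightarrow> 0 \<le> e2 \<Longrightarrow> error_dynamics 0 a v z a' v' \<Longrightarrow>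
      energy_rate a v z a' v' (transpose B *v a) + coupling_rate e1 e2 a v z a' v' (transpose B *v a)
      \<le> - \<rho> * (norm a)\<^sup>2 - g * (norm v)\<^sup>2
        + e2 * (c * ((norm a)\<^sup>2 + norm a * norm z + norm v * norm z) - k * (norm z)\<^sup>2)
        + e1 * (c * (norm a * norm v + (norm v)\<^sup>2 + norm v * norm z) - \<theta> * (norm a)\<^sup>2)"
proof -
  have "sym_pd R \<or> full_col_rank (transpose \<Gamma>)"
    using assms(2) by blast
  then obtain \<rho> \<theta> where \<rho>\<theta>: "0 \<le> \<rho>" "0 \<le> \<theta>" "0 < \<rho> + \<theta>"
    "\<And>a. \<rho> * (norm a)\<^sup>2 \<le> a \<bullet> (R *v a)" "\<And>a. \<theta> * (norm a)\<^sup>2 \<le> (norm (transpose \<Gamma> *v a))\<^sup>2"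
    by (rule current_damping) (rule that)
  obtain g where g: "0 < g" "\<And>v. g * (norm v)\<^sup>2 \<le> v \<bullet> (G *v v)"
    using sym_pd_coercive assms(2) by blast
  obtain c1 k where c1: "0 \<le> c1" "0 < k"
    "\<And>a v z a' v'. error_dynamics 0 a v z a' v' \<Longrightarrow>
      (L *v a') \<bullet> (B *v z) + (L *v a) \<bullet> (B *v (transpose B *v a))
      \<le> c1 * ((norm a)\<^sup>2 + norm a * norm z + norm v * norm z) - k * (norm z)\<^sup>2"
    by (rule current_coupling_rate_bound[OF assms(1)]) (rule that)
  obtain c2 where c2: "0 \<le> c2"
    "\<And>a v z a' v'. error_dynamics 0 a v z a' v' \<Longrightarrow>
      - ((C *v v') \<bullet> (transpose \<Gamma> *v a) + (C *v v) \<bullet> (transpose \<Gamma> *v a'))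
      \<le> c2 * (norm a * norm v + (norm v)\<^sup>2 + norm v * norm z) - (norm (transpose \<Gamma> *v a))\<^sup>2"
    by (rule voltage_coupling_rate_bound) (rule that)
  show thesis
  proof (rule that[OF \<rho>\<theta>(1-3) g(1) c1(2), of "max c1 c2"])
    show "0 \<le> max c1 c2"
      using c1(1) by simp
  next
    fix e1 e2 :: real and a :: "real^'s" and v :: "real^'r" and z :: "real^'m" and a' v'
    assume e: "0 \<le> e1" "0 \<le> e2" and ed: "error_dynamics 0 a v z a' v'"
    define P1 where "P1 = (norm a)\<^sup>2 + norm a * norm z + norm v * norm z"
    define P2 where "P2 = norm a * norm v + (norm v)\<^sup>2 + norm v * norm z"
    have P: "0 \<le> P1" "0 \<le> P2"
      by (simp_all add: P1_def P2_def)
    have "energy_rate a v z a' v' (transpose B *v a) \<le> - \<rho> * (norm a)\<^sup>2 - g * (norm v)\<^sup>2"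
      using energy_rate_le_dissipation[OF ed] inner_zero_left[of "transpose B *v a"] \<rho>\<theta>(4)[of a] g(2)[of v]
      by linarith
    moreover have "e2 * ((L *v a') \<bullet> (B *v z) + (L *v a) \<bullet> (B *v (transpose B *v a)))
        \<le> e2 * (max c1 c2 * P1 - k * (norm z)\<^sup>2)"
    proof (rule mult_left_mono[OF _ e(2)])
      show "(L *v a') \<bullet> (B *v z) + (L *v a) \<bullet> (B *v (transpose B *v a)) \<le> max c1 c2 * P1 - k * (norm z)\<^sup>2"
        using c1(3)[OF ed, folded P1_def] mult_right_mono[OF max.cobounded1 P(1), of c1 c2] by linarith
    qed
    moreover have "- (e1 * ((C *v v') \<bullet> (transpose \<Gamma> *v a) + (C *v v) \<bullet> (transpose \<Gamma> *v a')))
        \<le> e1 * (max c1 c2 * P2 - \<theta> * (norm a)\<^sup>2)"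
    proof -
      have "- ((C *v v') \<bullet> (transpose \<Gamma> *v a) + (C *v v) \<bullet> (transpose \<Gamma> *v a'))
          \<le> max c1 c2 * P2 - \<theta> * (norm a)\<^sup>2"
        using c2(2)[OF ed, folded P2_def] mult_right_mono[OF max.cobounded2 P(2), of c2 c1] \<rho>\<theta>(5)[of a]
        by linarith
      from mult_left_mono[OF this e(1)] show ?thesis
        by (simp add: algebra_simps)
    qed
    ultimately show "energy_rate a v z a' v' (transpose B *v a) + coupling_rate e1 e2 a v z a' v' (transpose B *v a)
        \<le> - \<rho> * (norm a)\<^sup>2 - g * (norm v)\<^sup>2 + e2 * (max c1 c2 * P1 - k * (norm z)\<^sup>2)
          + e1 * (max c1 c2 * P2 - \<theta> * (norm a)\<^sup>2)"
      unfolding coupling_rate_def by linarith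
  qed
qed

lemma strict_lyapunov_function:
  assumes "full_col_rank B" "(sym_pd R \<and> sym_pd G) \<or> (sym_pd G \<and> full_col_rank (transpose \<Gamma>))"
  obtains e1 e2 \<delta> m M where "0 < \<delta>" "0 < m" "0 < M"
    "\<And>a v z a' v'. error_dynamics 0 a v z a' v' \<Longrightarrow>
      energy_rate a v z a' v' (transpose B *v a) + coupling_rate e1 e2 a v z a' v' (transpose B *v a)
      \<le> - \<delta> * (norm (a, v, z))\<^sup>2"
    "\<And>a v z. m * (norm (a, v, z))\<^sup>2 \<le> energy a v z + coupling e1 e2 a v z"
    "\<And>a v z. energy a v z + coupling e1 e2 a v z \<le> M * (norm (a, v, z))\<^sup>2"
proof -
  obtain \<rho> \<theta> g k c where gains: "0 \<le> \<rho>" "0 \<le> \<theta>" "0 < \<rho> + \<theta>" "0 < g" "0 < k" "0 \<le> c"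
    and rate: "\<And>e1 e2 a v z a' v'. 0 \<le> e1 \<Longrightarrow> 0 \<le> e2 \<Longrightarrow> error_dynamics 0 a v z a' v' \<Longrightarrow>
      energy_rate a v z a' v' (transpose B *v a) + coupling_rate e1 e2 a v z a' v' (transpose B *v a)
      \<le> - \<rho> * (norm a)\<^sup>2 - g * (norm v)\<^sup>2
        + e2 * (c * ((norm a)\<^sup>2 + norm a * norm z + norm v * norm z) - k * (norm z)\<^sup>2)
        + e1 * (c * (norm a * norm v + (norm v)\<^sup>2 + norm v * norm z) - \<theta> * (norm a)\<^sup>2)"
    by (rule lyapunov_rate_estimate[OF assms]) (rule that)
  obtain l M where l: "0 < l" "0 < M" "\<And>a v z. l * (norm (a, v, z))\<^sup>2 \<le> energy a v z"
    and M: "\<And>a v z. energy a v z \<le> M * (norm (a, v, z))\<^sup>2"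
    by (rule energy_norm_bounds) (rule that)
  obtain e1 e2 \<delta> where e: "0 < e1" "0 < e2" "0 < \<delta>"
    and decay: "\<And>X Y Z. - \<rho> * X\<^sup>2 - g * Y\<^sup>2 + e2 * (c * (X\<^sup>2 + X * Z + Y * Z) - k * Z\<^sup>2)
      + e1 * (c * (X * Y + Y\<^sup>2 + Y * Z) - \<theta> * X\<^sup>2) \<le> - \<delta> * (X\<^sup>2 + Y\<^sup>2 + Z\<^sup>2)"
    and small: "\<And>X Y Z. matrix_bound\<^sup>2 * (e2 * X * Z + e1 * X * Y) \<le> l / 2 * (X\<^sup>2 + Y\<^sup>2 + Z\<^sup>2)"
    using strict_lyapunov_gains[OF gains, of "matrix_bound\<^sup>2" "l / 2"] l(1) by auto
  have coupling_small: "\<bar>coupling e1 e2 a v z\<bar> \<le> l / 2 * (norm (a, v, z))\<^sup>2" for a v z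
    using coupling_bound[of e1 e2 a v z] small[of "norm a" "norm z" "norm v"] e
    by (simp add: power2_norm_triple)
  have half: "l / 2 * N + l / 2 * N = l * N" for N :: real
    by (simp add: field_simps)
  show thesis
  proof (rule that[OF e(3), of "l / 2" "M + l / 2"])
    show "0 < l / 2" "0 < M + l / 2"
      using l(1,2) by simp_all
  next
    fix a :: "real^'s" and v :: "real^'r" and z :: "real^'m" and a' v'
    assume ed: "error_dynamics 0 a v z a' v'"
    have "energy_rate a v z a' v' (transpose B *v a) + coupling_rate e1 e2 a v z a' v' (transpose B *v a)
        \<le> - \<rho> * (norm a)\<^sup>2 - g * (norm v)\<^sup>2
          + e2 * (c * ((norm a)\<^sup>2 + norm a * norm z + norm v * norm z) - k * (norm z)\<^sup>2)
          + e1 * (c * (norm a * norm v + (norm v)\<^sup>2 + norm v * norm z) - \<theta> * (norm a)\<^sup>2)"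
      by (rule rate[OF less_imp_le[OF e(1)] less_imp_le[OF e(2)] ed])
    also have "\<dots> \<le> - \<delta> * ((norm a)\<^sup>2 + (norm v)\<^sup>2 + (norm z)\<^sup>2)"
      by (rule decay)
    finally show "energy_rate a v z a' v' (transpose B *v a) + coupling_rate e1 e2 a v z a' v' (transpose B *v a)
        \<le> - \<delta> * (norm (a, v, z))\<^sup>2"
      by (simp add: power2_norm_triple)
  next
    fix a :: "real^'s" and v :: "real^'r" and z :: "real^'m"
    have "(M + l / 2) * (norm (a, v, z))\<^sup>2 = M * (norm (a, v, z))\<^sup>2 + l / 2 * (norm (a, v, z))\<^sup>2"
      by (simp add: distrib_right)
    then show "l / 2 * (norm (a, v, z))\<^sup>2 \<le> energy a v z + coupling e1 e2 a v z"
      "energy a v z + coupling e1 e2 a v z \<le> (M + l / 2) * (norm (a, v, z))\<^sup>2"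
      using l(3)[of a v z] M[of a v z] coupling_small[of a v z] half[of "(norm (a, v, z))\<^sup>2"]
      by (simp_all add: abs_le_iff)
  qed
qed

lemma closed_loop_converges:
  assumes "full_col_rank B" "(sym_pd R \<and> sym_pd G) \<or> (sym_pd G \<and> full_col_rank (transpose \<Gamma>))"
    and traj: "cl_traj L C R G \<Gamma> B ki kd Ibar (\<lambda>_. 0) I V Ip Vp u"
  shows "((\<lambda>t. infdist (I t, V t, Ip t, Vp t, u t) (target_set B ki kd Ibar)) \<longlongrightarrow> 0) at_top"
proof -
  obtain e1 e2 \<delta> m M where pos: "0 < \<delta>" "0 < m" "0 < M"
    and rate: "\<And>a v z a' v'. error_dynamics 0 a v z a' v' \<Longrightarrow>
      energy_rate a v z a' v' (transpose B *v a) + coupling_rate e1 e2 a v z a' v' (transpose B *v a)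
      \<le> - \<delta> * (norm (a, v, z))\<^sup>2"
    and bounds: "\<And>a v z. m * (norm (a, v, z))\<^sup>2 \<le> energy a v z + coupling e1 e2 a v z"
      "\<And>a v z. energy a v z + coupling e1 e2 a v z \<le> M * (norm (a, v, z))\<^sup>2"
    by (rule strict_lyapunov_function[OF assms(1,2)]) (rule that)
  define z where "z t = transpose B *v (I t - Ibar)" for t
  define W where "W t = energy (Ip t) (Vp t) (z t) + coupling e1 e2 (Ip t) (Vp t) (z t)" for t
  have "((\<lambda>t. (Ip t, Vp t, z t)) \<longlongrightarrow> 0) at_top"
  proof (rule quadratic_lyapunov_tendsto_zero[OF pos(2,3,1)])
    fix t :: real
    assume t: "0 \<le> t"
    show "m * (norm (Ip t, Vp t, z t))\<^sup>2 \<le> W t" "W t \<le> M * (norm (Ip t, Vp t, z t))\<^sup>2"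
      using bounds by (simp_all add: W_def)
    obtain Ipp Vpp where Ipp: "(Ip has_vector_derivative Ipp) (at t within {0..})"
      and Vpp: "(Vp has_vector_derivative Vpp) (at t within {0..})"
      and dz: "((\<lambda>\<tau>. transpose B *v (I \<tau> - Ibar)) has_vector_derivative transpose B *v Ip t)
        (at t within {0..})"
      and ed: "error_dynamics 0 (Ip t) (Vp t) (transpose B *v (I t - Ibar)) Ipp Vpp"
      by (rule cl_traj_error_dynamics[OF traj t]) (rule that)
    have "(W has_real_derivative energy_rate (Ip t) (Vp t) (z t) Ipp Vpp (transpose B *v Ip t)
        + coupling_rate e1 e2 (Ip t) (Vp t) (z t) Ipp Vpp (transpose B *v Ip t)) (at t within {0..})"
      unfolding W_def z_def by (intro DERIV_add energy_has_derivative coupling_has_derivative Ipp Vpp dz)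
    then show "\<exists>D. (W has_real_derivative D) (at t within {0..}) \<and> D \<le> - \<delta> * (norm (Ip t, Vp t, z t))\<^sup>2"
      using rate[OF ed] unfolding z_def by blast
  qed
  then have norm_tendsto: "((\<lambda>t. norm (Ip t, Vp t, z t)) \<longlongrightarrow> 0) at_top"
    by (simp add: tendsto_norm_zero)
  obtain K where K: "\<And>I (V :: real^'r) Ip Vp u. infdist (I, V, Ip, Vp, u) (target_set B ki kd Ibar)
      \<le> K * norm (Ip, Vp, transpose B *v (I - Ibar))"
    by (rule infdist_target_set_le[OF assms(1)]) (rule that)
  have "\<forall>\<^sub>F t in at_top. norm (infdist (I t, V t, Ip t, Vp t, u t) (target_set B ki kd Ibar))
      \<le> K * norm (Ip t, Vp t, z t)"
  proof (intro always_eventually allI)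
    fix t
    have "norm (infdist (I t, V t, Ip t, Vp t, u t) (target_set B ki kd Ibar))
        = infdist (I t, V t, Ip t, Vp t, u t) (target_set B ki kd Ibar)"
      by (simp add: infdist_nonneg)
    also have "\<dots> \<le> K * norm (Ip t, Vp t, z t)"
      using K[of "I t" "V t" "Ip t" "Vp t" "u t"] by (simp only: z_def)
    finally show "norm (infdist (I t, V t, Ip t, Vp t, u t) (target_set B ki kd Ibar))
        \<le> K * norm (Ip t, Vp t, z t)" .
  qed
  then show ?thesis
    using tendsto_mult_right_zero[OF norm_tendsto] by (rule Lim_null_comparison)
qed

end

theorem theorem1:
  fixes L R :: "real^'s^'s" and C G :: "real^'r^'r" and \<Gamma> :: "real^'r^'s"
    and B :: "real^'m^'s" and Vstar :: "real^'r" and ubar :: "real^'m" and Ibar :: "real^'s"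
    and ki kd :: real
  assumes L: "sym_pd L" and C: "sym_pd C"
    and R: "sym_psd R" and G: "sym_psd G"
    and B: "full_col_rank B"
    and Vstar: "\<forall>j. Vstar $ j \<ge> 0"
    and eq1: "0 = \<Gamma> *v Vstar + R *v Ibar - B *v ubar"
    and eq2: "0 = transpose \<Gamma> *v Ibar - G *v Vstar"
    and kd: "kd > 0" and ki: "ki > 0"
  shows
    "(\<exists>S :: real^'s \<Rightarrow> real^'r \<Rightarrow> real^'s \<Rightarrow> real^'r \<Rightarrow> real^'m \<Rightarrow> real.
        (\<forall>I V Ip Vp u. S I V Ip Vp u \<ge> 0) \<and>
        (\<forall>mu I V Ip Vp u t. cl_traj L C R G \<Gamma> B ki kd Ibar mu I V Ip Vp u \<and> t \<ge> 0 \<longrightarrow>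
           (\<exists>D. ((\<lambda>\<tau>. S (I \<tau>) (V \<tau>) (Ip \<tau>) (Vp \<tau>) (u \<tau>)) has_real_derivative D) (at t within {0..}) \<and>
                D \<le> mu t \<bullet> out_y B (Ip t))))
     \<and>
     (((sym_pd R \<and> sym_pd G) \<or> (sym_pd G \<and> full_col_rank (transpose \<Gamma>))) \<longrightarrow>
        (\<forall>I V Ip Vp u. cl_traj L C R G \<Gamma> B ki kd Ibar (\<lambda>_. 0) I V Ip Vp u \<longrightarrow>
           ((\<lambda>t. infdist (I t, V t, Ip t, Vp t, u t) (target_set B ki kd Ibar)) \<longlongrightarrow> 0) at_top))"
proof -
  interpret rlc_closed_loop L R C G \<Gamma> B ki kd
    using L C R G ki kd by unfold_locales
  show ?thesis
    using closed_loop_passive closed_loop_converges[OF B] by blast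
qed

end
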